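(* For every sequence $\mu=(\mu_1,\mu_2,\dots)\in\Delta_\infty$ there exists a function $f\in\mathcal{A}$ with $\boldsymbol{\mu}_n(f)=\mu_n$ for every $n\geq 1$. That is, $\boldsymbol{\mu}(\mathcal{A})=\Delta_\infty$.
   Context: Let $I=[0,1]$ with Lebesgue measure $\mu_{\mathrm{Leb}}$, and $[n]=\{1,\dots,n\}$; permutations $\sigma\in S_n$ are bijections $[n]\to[n]$. For distinct reals $y_1,\dots,y_n$, $\mathrm{Order}(y_1,\dots,y_n)$ is the unique $\sigma\in S_n$ with $y_i<y_j$ iff $\sigma(i)<\sigma(j)$. Define $\rho:S_{n+1}\to S_n$ by $\rho(\sigma)=\mathrm{Order}(\sigma(1),\dots,\sigma(n))$. Let $\mathcal{A}$ be the set of functions $f:I\to I$ such that the set of points $x\in I$ with infinite orbit $\{x,f(x),f^2(x),\dots\}$ has Lebesgue measure $1$. Let $\Delta_n$ be the set of probability distributions on $S_n$. For $f\in\mathcal{A}$, $\boldsymbol{\mu}_n(f)\in\Delta_n$ is given by $\boldsymbol{\mu}_n(f)(\sigma)=\mu_{\mathrm{Leb}}\{x \text{ with infinite orbit} : \mathrm{Order}(x,f(x),\dots,f^{n-1}(x))=\sigma\}$, and $\boldsymbol{\mu}(f)=(\boldsymbol{\mu}_1(f),\boldsymbol{\mu}_2(f),\dots)$. Distributions $\mu\in\Delta_n$, $\mu'\in\Delta_{n+1}$ are compatible if $\mu(\sigma)=\sum_{\sigma'\in S_{n+1},\,\rho(\sigma')=\sigma}\mu'(\sigma')$ for all $\sigma\in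 S_n$. $\Delta_\infty$ is the set of sequences $(\mu_1,\mu_2,\dots)$ with $\mu_i\in\Delta_i$ and $\mu_i,\mu_{i+1}$ compatible for all $i\geq1$. *)

theory Defs
  imports "HOL-Analysis.Analysis" "HOL-Combinatorics.Permutations"
begin

text \<open>
  A permutation of \<open>{1..n}\<close> is a function on the naturals that is the identity outside
  \<open>{1..n}\<close>.
\<close>

definition Sym :: "nat \<Rightarrow> (nat \<Rightarrow> nat) set" where
  "Sym n = {\<sigma>. \<sigma> permutes {1..n}}"

text \<open>Only meaningful if \<open>y 1, \<dots>, y n\<close> are distinct.\<close>

definition Order :: "nat \<Rightarrow> (nat \<Rightarrow> real) \<Rightarrow> nat \<Rightarrow> nat" where
  "Order n y = (THE \<sigma>. \<sigma> \<in> Sym n \<and>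
     (\<forall>i\<in>{1..n}. \<forall>j\<in>{1..n}. y i < y j \<longleftrightarrow> \<sigma> i < \<sigma> j))"

text \<open>\<open>rho n\<close> maps \<open>Sym (Suc n)\<close> to \<open>Sym n\<close>.\<close>

definition rho :: "nat \<Rightarrow> (nat \<Rightarrow> nat) \<Rightarrow> nat \<Rightarrow> nat" where
  "rho n \<sigma> = Order n (\<lambda>i. real (\<sigma> i))"

text \<open>
  A distribution is given by its point masses, extended by 0 outside \<open>Sym n\<close>.
\<close>

definition Delta :: "nat \<Rightarrow> ((nat \<Rightarrow> nat) \<Rightarrow> real) set" where
  "Delta n = {p. (\<forall>\<sigma>\<in>Sym n. 0 \<le> p \<sigma>) \<and> (\<forall>\<sigma>. \<sigma> \<notin> Sym n \<longrightarrow> p \<sigma> = 0) \<and>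
     (\<Sum>\<sigma>\<in>Sym n. p \<sigma>) = 1}"

definition compatible ::
    "nat \<Rightarrow> ((nat \<Rightarrow> nat) \<Rightarrow> real) \<Rightarrow> ((nat \<Rightarrow> nat) \<Rightarrow> real) \<Rightarrow> bool" where
  "compatible n p p' \<longleftrightarrow>
     (\<forall>\<sigma>\<in>Sym n. p \<sigma> = (\<Sum>\<sigma>' | \<sigma>' \<in> Sym (Suc n) \<and> rho n \<sigma>' = \<sigma>. p' \<sigma>'))"

text \<open>Sequences are indexed by \<open>{1..}\<close>; the value at index 0 is \<open>undefined\<close>.\<close>

definition Delta_inf :: "(nat \<Rightarrow> (nat \<Rightarrow> nat) \<Rightarrow> real) set" where
  "Delta_inf = {\<mu> \<in> (\<Pi>\<^sub>E n\<in>{1..}. Delta n). \<forall>n\<ge>1. compatible n (\<mu> n) (\<mu> (Suc n))}"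

definition infinite_orbit_points :: "(real \<Rightarrow> real) \<Rightarrow> real set" where
  "infinite_orbit_points f = {x\<in>{0..1}. infinite (range (\<lambda>k. (f ^^ k) x))}"

definition pattern_set :: "(real \<Rightarrow> real) \<Rightarrow> nat \<Rightarrow> (nat \<Rightarrow> nat) \<Rightarrow> real set" where
  "pattern_set f n \<sigma> =
     {x \<in> infinite_orbit_points f. Order n (\<lambda>i. (f ^^ (i - 1)) x) = \<sigma>}"

text \<open>
  Functions \<open>I \<rightarrow> I\<close> are represented by functions on the reals mapping \<open>{0..1}\<close> into itself;
  their values elsewhere are irrelevant. The last clause says that every set whose Lebesgue
  measure enters the distributions \<open>mu f\<close> is Lebesgue measurable; without it these
  distributions are not defined. No measurability of \<open>f\<close> itself is required. Measurability
  of the set of points with infinite orbit follows from its measure being nonzero.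
\<close>

definition class_A :: "(real \<Rightarrow> real) set" where
  "class_A = {f. f \<in> {0..1} \<rightarrow> {0..1} \<and>
     emeasure lebesgue (infinite_orbit_points f) = 1 \<and>
     (\<forall>n\<ge>1. \<forall>\<sigma>\<in>Sym n. pattern_set f n \<sigma> \<in> sets lebesgue)}"

definition mu_n :: "nat \<Rightarrow> (real \<Rightarrow> real) \<Rightarrow> (nat \<Rightarrow> nat) \<Rightarrow> real" where
  "mu_n n f = (\<lambda>\<sigma>. measure lebesgue (pattern_set f n \<sigma>))"

definition mu :: "(real \<Rightarrow> real) \<Rightarrow> nat \<Rightarrow> (nat \<Rightarrow> nat) \<Rightarrow> real" where
  "mu f = (\<lambda>n\<in>{1..}. mu_n n f)"

end

theory Submission imports Defs begin

text \<open>
  Since \<open>f\<close> need not be measurable, it can send almost every point into a null set and do all its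
  work there. Splitting \<open>[0,1)\<close> into nested intervals of lengths \<open>\<mu> n \<sigma>\<close> attaches to every \<open>x\<close> a
  coherent sequence of permutations, that is, a linear order on the naturals, with the prescribed
  distribution. There are a null set and, inside it, pairwise disjoint dense sets \<open>D x\<close>, one for each
  real \<open>x\<close>. A countable linear order embeds into a dense set, also when one of its points is
  prescribed, so for \<open>x\<close> outside the null set there is a sequence starting at \<open>x\<close>, continuing in \<open>D x\<close>
  and ordered as \<open>x\<close> demands. As the \<open>D x\<close> are disjoint, these sequences are orbits of a single \<open>f\<close>.
\<close>

section \<open>Order patterns\<close>

lemma Sym_inj:
  assumes "\<sigma> \<in> Sym n"
  shows "\<sigma> i = \<sigma> j \<longleftrightarrow> i = j"
  using permutes_inj[of \<sigma> "{1..n}"] assms by (simp add: Sym_def inj_eq)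

text \<open>A permutation maps the indices with value at most \<open>\<sigma> i\<close> bijectively
  onto \<open>{1..\<sigma> i}\<close>. Values are thus ranks, and a rank depends only on how the
  permutation compares indices; uniqueness of order patterns follows.\<close>

lemma Sym_eq_card:
  assumes "\<sigma> \<in> Sym n" "i \<in> {1..n}"
  shows "\<sigma> i = card {j \<in> {1..n}. \<sigma> j \<le> \<sigma> i}"
proof -
  have p: "\<sigma> permutes {1..n}"
    using assms by (simp add: Sym_def)
  have "\<sigma> ` {j \<in> {1..n}. \<sigma> j \<le> \<sigma> i} = {1..\<sigma> i}"
  proof
    show "{1..\<sigma> i} \<subseteq> \<sigma> ` {j \<in> {1..n}. \<sigma> j \<le> \<sigma> i}"
    proof
      fix k assume k: "k \<in> {1..\<sigma> i}"
      have "\<sigma> i \<le> n"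
        using p assms(2) permutes_in_image[OF p, of i] by auto
      with k have "k \<in> \<sigma> ` {1..n}"
        using permutes_image[OF p] by auto
      with k show "k \<in> \<sigma> ` {j \<in> {1..n}. \<sigma> j \<le> \<sigma> i}"
        by auto
    qed
  next
    have "1 \<le> \<sigma> j" if "j \<in> {1..n}" for j
      using that permutes_in_image[OF p, of j] by simp
    then show "\<sigma> ` {j \<in> {1..n}. \<sigma> j \<le> \<sigma> i} \<subseteq> {1..\<sigma> i}"
      by (intro image_subsetI) auto
  qed
  moreover have "inj_on \<sigma> {j \<in> {1..n}. \<sigma> j \<le> \<sigma> i}"
    using permutes_inj[OF p] by (rule inj_on_subset) auto
  ultimately show ?thesis
    using card_image[of \<sigma> "{j \<in> {1..n}. \<sigma> j \<le> \<sigma> i}"] by simp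
qed

lemma Sym_eqI:
  assumes "\<sigma> \<in> Sym n" "\<tau> \<in> Sym n"
    and "\<And>i j. i \<in> {1..n} \<Longrightarrow> j \<in> {1..n} \<Longrightarrow> \<sigma> i < \<sigma> j \<longleftrightarrow> \<tau> i < \<tau> j"
  shows "\<sigma> = \<tau>"
proof
  fix i
  show "\<sigma> i = \<tau> i"
  proof (cases "i \<in> {1..n}")
    case True
    then have "{j \<in> {1..n}. \<sigma> j \<le> \<sigma> i} = {j \<in> {1..n}. \<tau> j \<le> \<tau> i}"
      using assms(3)[OF True] by (force simp: not_less[symmetric])
    then show ?thesis
      using Sym_eq_card[OF assms(1) True] Sym_eq_card[OF assms(2) True] by simp
  next
    case False
    with assms(1,2) show ?thesis
      by (simp add: Sym_def permutes_def)
  qed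
qed

lemma ex_Sym_order:
  fixes y :: "nat \<Rightarrow> real"
  assumes "inj_on y {1..n}"
  shows "\<exists>\<sigma>\<in>Sym n. \<forall>i\<in>{1..n}. \<forall>j\<in>{1..n}. y i < y j \<longleftrightarrow> \<sigma> i < \<sigma> j"
proof -
  define B where "B i = {j \<in> {1..n}. y j \<le> y i}" for i
  \<comment> \<open>The witness is the rank function: \<open>y i < y j\<close> makes
    \<open>B i\<close> a proper subset of \<open>B j\<close>, the point \<open>j\<close> itself
    being new.\<close>
  define \<sigma> where "\<sigma> i = (if i \<in> {1..n} then card (B i) else i)" for i
  have lt: "card (B i) < card (B j)" if "y i < y j" "j \<in> {1..n}" for i j
  proof (rule psubset_card_mono)
    have "j \<in> B j" "j \<notin> B i" "B i \<subseteq> B j"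
      using that by (auto simp: B_def)
    then show "B i \<subset> B j"
      by blast
  qed (simp add: B_def)
  have iff: "y i < y j \<longleftrightarrow> \<sigma> i < \<sigma> j" if "i \<in> {1..n}" "j \<in> {1..n}" for i j
  proof -
    have "i = j" if "y i = y j"
      using inj_onD[OF assms that] \<open>i \<in> {1..n}\<close> \<open>j \<in> {1..n}\<close> .
    then show ?thesis
      using that lt[of i j] lt[of j i]
      by (cases "y i" "y j" rule: linorder_cases) (simp_all add: \<sigma>_def)
  qed
  have inj: "inj_on \<sigma> {1..n}"
  proof (rule inj_onI)
    fix i j assume ij: "i \<in> {1..n}" "j \<in> {1..n}" and "\<sigma> i = \<sigma> j"
    then have "\<not> y i < y j" "\<not> y j < y i"
      by (simp_all only: iff less_irrefl not_False_eq_True)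
    then have "y i = y j"
      by simp
    then show "i = j"
      using ij by (rule inj_onD[OF assms])
  qed
  have "\<sigma> ` {1..n} \<subseteq> {1..n}"
  proof clarify
    fix i assume i: "i \<in> {1..n}"
    then have "i \<in> B i"
      by (simp add: B_def)
    moreover have sub: "B i \<subseteq> {1..n}"
      by (auto simp: B_def)
    ultimately have "0 < card (B i)"
      using finite_subset[OF sub] by (auto simp: card_gt_0_iff)
    moreover have "card (B i) \<le> n"
      using card_mono[OF _ sub] by simp
    ultimately show "\<sigma> i \<in> {1..n}"
      using i by (simp add: \<sigma>_def)
  qed
  with inj have "bij_betw \<sigma> {1..n} {1..n}"
    by (simp add: bij_betw_def endo_inj_surj)
  then have "\<sigma> \<in> Sym n"
    unfolding Sym_def mem_Collect_eq by (rule bij_imp_permutes) (auto simp: \<sigma>_def)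
  with iff show ?thesis
    by (intro bexI[of _ \<sigma>] ballI)
qed

text \<open>Existence by ranks and uniqueness by \<open>Sym_eqI\<close> turn the definite
  description into a characterisation; everything later about \<open>Order\<close> goes through
  it.\<close>

lemma Order_eq_iff:
  assumes "inj_on y {1..n}"
  shows "Order n y = \<sigma> \<longleftrightarrow>
    \<sigma> \<in> Sym n \<and> (\<forall>i\<in>{1..n}. \<forall>j\<in>{1..n}. y i < y j \<longleftrightarrow> \<sigma> i < \<sigma> j)"
proof -
  obtain \<tau> where \<tau>: "\<tau> \<in> Sym n" "\<forall>i\<in>{1..n}. \<forall>j\<in>{1..n}. y i < y j \<longleftrightarrow> \<tau> i < \<tau> j"
    using ex_Sym_order[OF assms] by blast
  have uniq: "\<sigma> = \<tau>"
    if "\<sigma> \<in> Sym n" "\<forall>i\<in>{1..n}. \<forall>j\<in>{1..n}. y i < y j \<longleftrightarrow> \<sigma> i < \<sigma> j" for \<sigma>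
    using that \<tau> by (intro Sym_eqI) auto
  have "Order n y = \<tau>"
    unfolding Order_def by (rule the_equality, rule conjI[OF \<tau>], elim conjE, rule uniq)
  moreover have "\<tau> = \<sigma> \<longleftrightarrow>
      \<sigma> \<in> Sym n \<and> (\<forall>i\<in>{1..n}. \<forall>j\<in>{1..n}. y i < y j \<longleftrightarrow> \<sigma> i < \<sigma> j)"
  proof
    assume eq: "\<tau> = \<sigma>"
    show "\<sigma> \<in> Sym n \<and> (\<forall>i\<in>{1..n}. \<forall>j\<in>{1..n}. y i < y j \<longleftrightarrow> \<sigma> i < \<sigma> j)"
      using \<tau> unfolding eq by (intro conjI)
  qed (elim conjE, rule uniq[symmetric])
  ultimately show ?thesis
    by (simp only:)
qed

lemma Order_in_Sym: "inj_on y {1..n} \<Longrightarrow> Order n y \<in> Sym n"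
  using Order_eq_iff[of y n "Order n y"] by simp

lemma Order_less_iff:
  assumes "inj_on y {1..n}" "i \<in> {1..n}" "j \<in> {1..n}"
  shows "Order n y i < Order n y j \<longleftrightarrow> y i < y j"
  using Order_eq_iff[OF assms(1), of "Order n y"] assms(2,3) by simp

lemma inj_on_Sym_real: "\<sigma> \<in> Sym m \<Longrightarrow> inj_on (\<lambda>i. real (\<sigma> i)) A"
  by (auto simp: inj_on_def dest: Sym_inj)

lemma rho_in_Sym: "\<sigma> \<in> Sym m \<Longrightarrow> rho n \<sigma> \<in> Sym n"
  unfolding rho_def by (intro Order_in_Sym inj_on_Sym_real)

lemma rho_less_iff:
  assumes "\<sigma> \<in> Sym m" "i \<in> {1..n}" "j \<in> {1..n}"
  shows "rho n \<sigma> i < rho n \<sigma> j \<longleftrightarrow> \<sigma> i < \<sigma> j"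
  unfolding rho_def using assms(2,3) by (simp add: Order_less_iff[OF inj_on_Sym_real[OF assms(1)]])

text \<open>On \<open>{1..n}\<close> both sides compare indices as \<open>y\<close> does. This is
  the source of the compatibility of the distributions of a function.\<close>

lemma rho_Order:
  assumes "inj_on y {1..Suc n}"
  shows "rho n (Order (Suc n) y) = Order n y"
proof -
  have inj: "inj_on y {1..n}"
    using assms by (rule inj_on_subset) auto
  have "Order n y = rho n (Order (Suc n) y)"
    unfolding Order_eq_iff[OF inj] using assms
    by (auto simp: rho_less_iff[OF Order_in_Sym] Order_less_iff
        intro!: rho_in_Sym[OF Order_in_Sym])
  then show ?thesis ..
qed

lemma finite_Sym: "finite (Sym n)"
  unfolding Sym_def by (rule finite_permutations) simp

lemma inj_iterates_of_infinite_orbit: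
  fixes f :: "'a \<Rightarrow> 'a"
  assumes "infinite (range (\<lambda>k. (f ^^ k) x))"
  shows "inj (\<lambda>k. (f ^^ k) x)"
proof (rule ccontr)
  assume "\<not> inj (\<lambda>k. (f ^^ k) x)"
  then obtain i j where ij: "i < j" "(f ^^ i) x = (f ^^ j) x"
    unfolding inj_on_def by (metis linorder_neqE_nat)
  have "(f ^^ k) x \<in> (\<lambda>k. (f ^^ k) x) ` {..<j}" for k
  proof (induction k rule: less_induct)
    case (less k)
    show ?case
    proof (cases "k < j")
      case False
      \<comment> \<open>The iterates with indices \<open>i\<close> and \<open>j\<close> agree, so an
        index beyond \<open>j\<close> can be lowered by \<open>j - i\<close>; the orbit then lies
        among its first \<open>j\<close> points.\<close>
      then have "(f ^^ k) x = (f ^^ (k - j)) ((f ^^ j) x)"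
        using funpow_add[of "k - j" j f] by simp
      also have "\<dots> = (f ^^ (k - j + i)) x"
        by (simp add: funpow_add ij(2))
      finally show ?thesis
        using less[of "k - j + i"] ij(1) False by simp
    qed auto
  qed
  then have "range (\<lambda>k. (f ^^ k) x) \<subseteq> (\<lambda>k. (f ^^ k) x) ` {..<j}"
    by blast
  with assms show False
    using finite_subset by blast
qed

lemma inj_on_comp_pred:
  assumes "inj a"
  shows "inj_on (\<lambda>i. a (i - 1)) {1..n :: nat}"
proof (rule inj_onI)
  fix i j assume ij: "i \<in> {1..n}" "j \<in> {1..n}" "a (i - 1) = a (j - 1)"
  then have "i - 1 = j - 1"
    using injD[OF assms] by blast
  then show "i = j"
    using ij(1,2) by (metis One_nat_def Suc_diff_1 atLeastAtMost_iff less_eq_Suc_le)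
qed

lemma inj_on_iterates:
  assumes "x \<in> infinite_orbit_points f"
  shows "inj_on (\<lambda>i. (f ^^ (i - 1)) x) {1..n}"
  using assms
  by (intro inj_on_comp_pred inj_iterates_of_infinite_orbit) (simp add: infinite_orbit_points_def)

text \<open>Both requirements are finite additivity: the pattern sets of level \<open>n\<close>
  partition the points with infinite orbit, and \<open>rho_Order\<close> shows that those of level
  \<open>Suc n\<close> refine them along \<open>rho\<close>.\<close>

lemma mu_in_Delta_inf:
  assumes f: "f \<in> class_A"
  shows "mu f \<in> Delta_inf"
proof -
  have X: "emeasure lebesgue (infinite_orbit_points f) = 1"
    using f by (simp add: class_A_def)
  have meas: "pattern_set f n \<sigma> \<in> sets lebesgue" if "n \<ge> 1" "\<sigma> \<in> Sym n" for n \<sigma>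
    using f that by (simp add: class_A_def)
  have fm: "pattern_set f n \<sigma> \<in> fmeasurable lebesgue" if "n \<ge> 1" "\<sigma> \<in> Sym n" for n \<sigma>
  proof (rule fmeasurableI2)
    show "infinite_orbit_points f \<in> fmeasurable lebesgue"
      \<comment> \<open>\<open>emeasure\<close> is 0 on non-measurable sets, so the value 1 forces
        measurability.\<close>
      using X emeasure_notin_sets[of "infinite_orbit_points f" lebesgue]
      by (intro fmeasurableI) auto
  qed (use meas that in \<open>auto simp: pattern_set_def\<close>)
  have disj: "disjoint_family_on (pattern_set f n) S" for n S
    by (auto simp: disjoint_family_on_def pattern_set_def)
  have D: "mu_n n f \<in> Delta n" if n: "n \<ge> 1" for n
  proof -
    have "(\<Union>\<sigma>\<in>Sym n. pattern_set f n \<sigma>) = infinite_orbit_points f"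
      using Order_in_Sym[OF inj_on_iterates] by (auto simp: pattern_set_def)
    moreover have "measure lebesgue (\<Union>\<sigma>\<in>Sym n. pattern_set f n \<sigma>) =
      (\<Sum>\<sigma>\<in>Sym n. measure lebesgue (pattern_set f n \<sigma>))"
      using fmeasurableD[OF fm[OF n]] fmeasurableD2[OF fm[OF n]]
      by (intro measure_finite_Union finite_Sym disj) auto
    moreover have "pattern_set f n \<sigma> = {}" if "\<sigma> \<notin> Sym n" for \<sigma>
      using that Order_in_Sym[OF inj_on_iterates] by (auto simp: pattern_set_def)
    ultimately show ?thesis
      using X by (auto simp: Delta_def mu_n_def measure_def)
  qed
  have C: "compatible n (mu_n n f) (mu_n (Suc n) f)" for n
    unfolding compatible_def
  proof
    fix \<sigma> assume "\<sigma> \<in> Sym n"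
    let ?T = "{\<sigma>'. \<sigma>' \<in> Sym (Suc n) \<and> rho n \<sigma>' = \<sigma>}"
    have "pattern_set f n \<sigma> = (\<Union>\<sigma>'\<in>?T. pattern_set f (Suc n) \<sigma>')"
      using Order_in_Sym[OF inj_on_iterates] rho_Order[OF inj_on_iterates]
      by (auto simp: pattern_set_def)
    moreover have "measure lebesgue (\<Union>\<sigma>'\<in>?T. pattern_set f (Suc n) \<sigma>') =
      (\<Sum>\<sigma>'\<in>?T. measure lebesgue (pattern_set f (Suc n) \<sigma>'))"
      using fmeasurableD[OF fm, of "Suc n"] fmeasurableD2[OF fm, of "Suc n"] finite_Sym[of "Suc n"]
      by (intro measure_finite_Union disj) auto
    ultimately show "mu_n n f \<sigma> = (\<Sum>\<sigma>'\<in>?T. mu_n (Suc n) f \<sigma>')"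
      by (simp add: mu_n_def)
  qed
  show ?thesis
    using C D by (auto simp: Delta_inf_def mu_def)
qed

section \<open>Disjoint dense sets in a null set\<close>

text \<open>Covers of the Cantor set of reals with base 4 digits 0 and 1 only. Each stage is two
  copies of the previous one scaled by 1/4, so the measure at least halves. The maps are written in
  the shape of \<open>emeasure_lebesgue_affine\<close>.\<close>

fun cantor_cover :: "nat \<Rightarrow> real set" where
  "cantor_cover 0 = {0..1}"
| "cantor_cover (Suc n) =
    (\<lambda>x. (1/4) *\<^sub>R x + 0) ` cantor_cover n \<union> (\<lambda>x. (1/4) *\<^sub>R x + 1/4) ` cantor_cover n"

lemma compact_cantor_cover: "compact (cantor_cover n)"
  by (induction n) (auto intro!: compact_Un compact_continuous_image continuous_intros)

lemma emeasure_cantor_cover: "emeasure lebesgue (cantor_cover n) \<le> ennreal ((1/2) ^ n)"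
proof (induction n)
  case (Suc n)
  let ?A = "\<lambda>c. (\<lambda>x. (1/4::real) *\<^sub>R x + c) ` cantor_cover n"
  have m: "?A c \<in> sets lebesgue" for c
    using compact_cantor_cover
    by (intro fmeasurableD[OF lmeasurable_compact] compact_continuous_image continuous_intros)
  have "emeasure lebesgue (cantor_cover (Suc n)) \<le> emeasure lebesgue (?A 0) + emeasure lebesgue (?A (1/4))"
    unfolding cantor_cover.simps by (intro emeasure_subadditive m)
  also have "\<dots> = ennreal (1/4) * emeasure lebesgue (cantor_cover n)
      + ennreal (1/4) * emeasure lebesgue (cantor_cover n)"
    using emeasure_lebesgue_affine[of "1/4" 0 "cantor_cover n"]
      emeasure_lebesgue_affine[of "1/4" "1/4" "cantor_cover n"] by simp
  also have "\<dots> = ennreal (1/2) * emeasure lebesgue (cantor_cover n)"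
    by (simp flip: distrib_right ennreal_plus)
  also have "\<dots> \<le> ennreal (1/2) * ennreal ((1/2) ^ n)"
    using Suc by (intro mult_left_mono) auto
  also have "\<dots> = ennreal ((1/2) ^ Suc n)"
    by (simp only: ennreal_mult[symmetric] power_Suc zero_le_power zero_le_divide_1_iff zero_le_numeral)
  finally show ?case .
qed simp

lemma null_Inter_cantor_cover: "(\<Inter>n. cantor_cover n) \<in> null_sets lebesgue"
proof -
  have m: "cantor_cover n \<in> sets lebesgue" for n
    using compact_cantor_cover lmeasurable_compact by blast
  have "emeasure lebesgue (\<Inter>n. cantor_cover n) \<le> 0"
  proof (rule LIMSEQ_le_const)
    show "(\<lambda>n. ennreal ((1/2) ^ n)) \<longlonglongrightarrow> 0"
      using tendsto_ennrealI[OF LIMSEQ_power_zero[of "1/2::real"]] by simp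
    have "emeasure lebesgue (\<Inter>n. cantor_cover n) \<le> ennreal ((1/2) ^ n)" for n
      using emeasure_mono[of "\<Inter>n. cantor_cover n" "cantor_cover n" lebesgue] m
        emeasure_cantor_cover[of n] by (meson INT_lower UNIV_I order_trans)
    then show "\<exists>N. \<forall>n\<ge>N. emeasure lebesgue (\<Inter>n. cantor_cover n) \<le> ennreal ((1/2) ^ n)"
      by blast
  qed
  with m show ?thesis
    by (auto simp: null_sets_def)
qed

definition cantor_point :: "(nat \<Rightarrow> bool) \<Rightarrow> real" where
  "cantor_point b = (\<Sum>n. of_bool (b n) * (1/4) ^ Suc n)"

lemma summable_cantor_point: "summable (\<lambda>n. of_bool (b n) * (1/4 :: real) ^ Suc n)"
  by (rule summable_comparison_test'[of "\<lambda>n. (1/4) ^ Suc n" 0])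
    (auto simp: summable_geometric summable_mult)

text \<open>The bound 1/3 is the value with all digits 1. Being below 1, it makes expansions with
  digits 0 and 1 unique in base 4.\<close>

lemma cantor_point_bounds: "0 \<le> cantor_point b" "cantor_point b \<le> 1/3"
proof -
  show "0 \<le> cantor_point b"
    unfolding cantor_point_def by (intro suminf_nonneg summable_cantor_point) simp
  have "(\<lambda>n. (1/4 :: real) ^ Suc n) sums (1/3)"
    using sums_mult[OF geometric_sums[of "1/4::real"], of "1/4"] by simp
  moreover have "cantor_point b \<le> (\<Sum>n. (1/4) ^ Suc n)"
    unfolding cantor_point_def
    by (intro suminf_le summable_cantor_point) (auto intro: sums_summable[OF calculation])
  ultimately show "cantor_point b \<le> 1/3"
    by (simp add: sums_iff)
qed

lemma cantor_point_shift:
  "cantor_point b = of_bool (b 0) / 4 + cantor_point (\<lambda>n. b (Suc n)) / 4"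
  using suminf_split_head[OF summable_cantor_point[of b]]
    suminf_mult[OF summable_cantor_point[of "\<lambda>n. b (Suc n)"], of "1/4"]
  by (simp add: cantor_point_def mult_ac)

text \<open>Splitting off the first digit, as in \<open>cantor_point_shift\<close>, selects one of
  the two affine maps in the recursion of the covers.\<close>

lemma cantor_point_in_cover: "cantor_point b \<in> cantor_cover n"
proof (induction n arbitrary: b)
  case 0
  show ?case
    using cantor_point_bounds[of b] by simp
next
  case (Suc n)
  show ?case
    using Suc[of "\<lambda>n. b (Suc n)"] by (subst cantor_point_shift) (auto simp: image_def)
qed

text \<open>If the first digits differed, one value would be at least 1/4 and the other at most
  1/12. So they agree, hence the tails have equal values, and induction reaches every digit.\<close>

lemma inj_cantor_point: "inj cantor_point"
proof (rule injI)
  fix b c :: "nat \<Rightarrow> bool"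
  assume "cantor_point b = cantor_point c"
  then have "b n = c n" for n
  proof (induction n arbitrary: b c)
    have *: "b 0 = c 0" "cantor_point (\<lambda>n. b (Suc n)) = cantor_point (\<lambda>n. c (Suc n))"
      if "cantor_point b = cantor_point c" for b c
      using that cantor_point_shift[of b] cantor_point_shift[of c]
        cantor_point_bounds[of "\<lambda>n. b (Suc n)"] cantor_point_bounds[of "\<lambda>n. c (Suc n)"]
      by (auto simp: of_bool_def split: if_splits)
    case 0
    then show ?case
      by (rule *)
    case (Suc n)
    then show ?case
      using *(2)[OF Suc.prems] Suc.IH[of "\<lambda>n. b (Suc n)" "\<lambda>n. c (Suc n)"] by simp
  qed
  then show "b = c" ..
qed

lemma ex_null_inj: "\<exists>(C :: real set) (h :: real \<Rightarrow> real). C \<in> null_sets lebesgue \<and> inj h \<and> range h \<subseteq> C"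
proof (intro exI conjI)
  \<comment> \<open>Dedekind cuts as 0-1 sequences: \<open>e x\<close> marks the enumerated
    rationals below \<open>x\<close>, and a rational between two reals separates their
    sequences.\<close>
  define e :: "real \<Rightarrow> nat \<Rightarrow> bool" where "e x n \<longleftrightarrow> of_rat (from_nat n) < x" for x n
  have "e x \<noteq> e y" if xy: "x < y" for x y
  proof -
    obtain q where "x < of_rat q" "of_rat q < y"
      using of_rat_dense[OF xy] by blast
    then have "e x (to_nat q) \<noteq> e y (to_nat q)"
      by (simp add: e_def)
    then show ?thesis
      by metis
  qed
  then have "inj e"
    by (metis injI linorder_neqE_linordered_idom)
  then show "inj (\<lambda>x. cantor_point (e x))"
    using inj_compose[OF inj_cantor_point, of e] by (simp add: comp_def)
  show "range (\<lambda>x. cantor_point (e x)) \<subseteq> (\<Inter>n. cantor_cover n)"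
    using cantor_point_in_cover by blast
qed (rule null_Inter_cantor_cover)

text \<open>
  The sets \<open>D x\<close> are distinct cosets of the rationals. The cosets meeting a null set \<open>C\<close> of
  the cardinality of the continuum are as numerous as the reals, since each of them is countable.
\<close>

lemma ex_null_disjoint_dense_family:
  includes cardinal_syntax
  obtains N :: "real set" and D :: "real \<Rightarrow> real set"
  where "N \<in> null_sets lebesgue" "\<And>x. D x \<subseteq> N" "\<And>x y. x \<noteq> y \<Longrightarrow> D x \<inter> D y = {}"
    "\<And>x u v. u < v \<Longrightarrow> \<exists>d\<in>D x. u < d \<and> d < v"
proof -
  obtain C :: "real set" and h :: "real \<Rightarrow> real"
    where C: "C \<in> null_sets lebesgue" and h: "inj h" "range h \<subseteq> C"
    using ex_null_inj by blast
  define coset :: "real \<Rightarrow> real set" where "coset c = (\<lambda>q. c + q) ` \<rat>" for c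
  have eq: "coset c = coset d" if x: "x \<in> coset c" "x \<in> coset d" for x c d
  proof -
    have sub: "coset c \<subseteq> coset d" if "x \<in> coset c" "x \<in> coset d" for c d
    proof -
      obtain q r where qr: "q \<in> \<rat>" "r \<in> \<rat>" "c + q = d + r"
        using \<open>x \<in> coset c\<close> \<open>x \<in> coset d\<close> unfolding coset_def by blast
      show ?thesis
        unfolding coset_def
      proof (intro image_subsetI)
        fix t :: real assume t: "t \<in> \<rat>"
        show "c + t \<in> (+) d ` \<rat>"
        proof (rule image_eqI)
          show "c + t = d + (r - q + t)"
            using qr(3) by simp
          show "r - q + t \<in> \<rat>"
            using qr t by simp
        qed
      qed
    qed
    show ?thesis
      using x by (intro equalityI sub)
  qed
  have self: "c \<in> coset c" for c
    unfolding coset_def by (rule image_eqI[of _ _ 0]) auto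
  define K where "K = coset ` C"
  \<comment> \<open>A point is recovered from its coset, through a chosen representative, and a
    rational offset. So \<open>C\<close> is no larger than \<open>K \<times> \<rat>\<close>.\<close>
  define F where "F = (\<lambda>(k, q). (SOME c. coset c = k) + q)"
  have cover: "C \<subseteq> F ` (K \<times> \<rat>)"
  proof
    fix c assume c: "c \<in> C"
    define d where "d = (SOME d. coset d = coset c)"
    have "coset d = coset c"
      unfolding d_def by (rule someI) simp
    then obtain q where "q \<in> \<rat>" "c = d + q"
      using self[of c] unfolding coset_def by blast
    then show "c \<in> F ` (K \<times> \<rat>)"
      using c by (auto simp: F_def K_def d_def intro!: image_eqI[of _ _ "(coset c, q)"])
  qed
  \<comment> \<open>Were \<open>K\<close> finite, \<open>cover\<close> would make \<open>C\<close>
    countable. Infinity of \<open>K\<close> is what lets the countable factor be absorbed in the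
    cardinality chain below.\<close>
  have "uncountable C"
    using h countable_subset[OF h(2)] countable_image_inj_on[OF _ h(1)] uncountable_UNIV_real
    by blast
  then have inf: "infinite K"
    using cover countable_subset[OF cover] countable_finite[of K] countable_rat
    by (meson countable_SIGMA countable_image)
  have "|UNIV :: real set| \<le>o |C|"
    using h card_of_ordLeq by blast
  also have "|C| \<le>o |F ` (K \<times> \<rat>)|"
    using cover by (rule card_of_mono1)
  also have "|F ` (K \<times> \<rat>)| \<le>o |K \<times> (\<rat> :: real set)|"
    by (rule card_of_image)
  also have "|K \<times> (\<rat> :: real set)| =o |K|"
  proof -
    have "|\<rat> :: real set| \<le>o |UNIV :: nat set|"
      using countable_rat unfolding countable_def card_of_ordLeq[symmetric] by blast
    also have "|UNIV :: nat set| \<le>o |K|"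
      using inf infinite_iff_card_of_nat by blast
    finally have "|\<rat> :: real set| \<le>o |K|" .
    then show ?thesis
      using card_of_Times_infinite[OF inf, of \<rat>] Rats_0 by blast
  qed
  finally have "|UNIV :: real set| \<le>o |K|" .
  then obtain D :: "real \<Rightarrow> real set" where D: "inj D" "range D \<subseteq> K"
    using card_of_ordLeq[of "UNIV :: real set" K] by blast
  show thesis
  proof
    \<comment> \<open>The union of the cosets meeting \<open>C\<close> is also the union of the
      countably many rational translates of \<open>C\<close>, hence null.\<close>
    have "(\<lambda>c. q + c) ` C \<in> null_sets lebesgue" for q
      using C negligible_translation[of C q] by (simp add: negligible_iff_null_sets)
    then have "(\<Union>q\<in>\<rat>. (\<lambda>c. q + c) ` C) \<in> null_sets lebesgue"
      by (intro null_sets_UN' countable_rat)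
    also have "(\<Union>q\<in>\<rat>. (\<lambda>c. q + c) ` C) = (\<Union>c\<in>C. coset c)"
      by (auto simp: coset_def add.commute)
    finally show "(\<Union>c\<in>C. coset c) \<in> null_sets lebesgue" .
    show "D x \<subseteq> (\<Union>c\<in>C. coset c)" for x
      using D(2) by (auto simp: K_def)
    show "D x \<inter> D y = {}" if xy: "x \<noteq> y" for x y
    proof (rule ccontr)
      obtain c d where cd: "D x = coset c" "D y = coset d"
        using D(2) unfolding K_def by (metis image_iff range_subsetD)
      moreover assume "D x \<inter> D y \<noteq> {}"
      ultimately have "D x = D y"
        using eq by blast
      with xy D(1) show False
        by (auto dest: injD)
    qed
    show "\<exists>d\<in>D x. u < d \<and> d < v" if uv: "u < v" for x u v
    proof -
      obtain c where c: "D x = coset c"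
        using D(2) unfolding K_def by (metis image_iff range_subsetD)
      obtain q where "q \<in> \<rat>" "u - c < q" "q < v - c"
        using Rats_dense_in_real[of "u - c" "v - c"] uv by (meson diff_strict_right_mono)
      then have "c + q \<in> D x" "u < c + q" "c + q < v"
        unfolding c coset_def by (blast, linarith+)
      then show ?thesis
        by blast
    qed
  qed
qed

section \<open>Realising coherent sequences of permutations\<close>

text \<open>The forth half of Cantor's back-and-forth argument: each new value is chosen in
  \<open>D\<close> between the finitely many earlier ones. The value \<open>x\<close> can be
  prescribed because index 0 comes first and meets no constraint except the interval.\<close>

lemma ex_order_embedding:
  fixes lt :: "nat \<Rightarrow> nat \<Rightarrow> bool" and x l r :: real
  assumes irrefl: "\<And>i. \<not> lt i i"
    and trans: "\<And>i j k. lt i j \<Longrightarrow> lt j k \<Longrightarrow> lt i k"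
    and total: "\<And>i j. i \<noteq> j \<Longrightarrow> lt i j \<or> lt j i"
    and dense: "\<And>u v. u < v \<Longrightarrow> \<exists>d\<in>D. u < d \<and> d < v"
    and x: "x \<in> {l<..<r}"
  obtains a :: "nat \<Rightarrow> real"
  where "a 0 = x" "\<And>k. k > 0 \<Longrightarrow> a k \<in> D" "\<And>k. a k \<in> {l<..<r}" "\<And>i j. a i < a j \<longleftrightarrow> lt i j"
proof -
  define P where "P a k y \<longleftrightarrow> (if k = 0 then y = x else y \<in> D) \<and> y \<in> {l<..<r} \<and>
    (\<forall>j<k. (lt j k \<longrightarrow> a j < y) \<and> (lt k j \<longrightarrow> y < a j))" for a and k :: nat and y
  have "\<exists>a. \<forall>k. P a k (a k)"
  proof (rule dependent_wellorder_choice)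
    fix y k and a b :: "nat \<Rightarrow> real"
    assume "\<And>j. j < k \<Longrightarrow> a j = b j"
    then show "P a k y = P b k y"
      by (simp add: P_def)
  next
    fix k a
    assume IH: "\<And>j. j < k \<Longrightarrow> P a j (a j)"
    show "\<exists>y. P a k y"
    proof (cases "k = 0")
      case True
      then show ?thesis
        using x by (simp add: P_def)
    next
      case False
      \<comment> \<open>\<open>L\<close> and \<open>U\<close> hold what must lie below and above the
        new value. The endpoints keep both sets nonempty and the new value inside the
        interval.\<close>
      define L where "L = insert l (a ` {j. j < k \<and> lt j k})"
      define U where "U = insert r (a ` {j. j < k \<and> lt k j})"
      have fin: "finite L" "finite U" and ne: "L \<noteq> {}" "U \<noteq> {}"
        by (auto simp: L_def U_def)
      have bounds: "l < a j" "a j < r" if "j < k" for j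
        using IH[OF that] by (auto simp: P_def)
      have mono: "a i < a j" if "i < k" "j < k" "lt i j" for i j
      proof (cases i j rule: linorder_cases)
        case less
        then show ?thesis
          using IH[OF that(2)] that(3) by (simp add: P_def)
      next
        case equal
        then show ?thesis
          using irrefl that(3) by simp
      next
        case greater
        then show ?thesis
          using IH[OF that(1)] that(3) by (simp add: P_def)
      qed
      have "u < v" if "u \<in> L" "v \<in> U" for u v
      proof -
        have "l < r"
          using x by simp
        \<comment> \<open>Transitivity through \<open>k\<close>: an index below \<open>k\<close> is
          below an index above \<open>k\<close>, and \<open>a\<close> already respects this.\<close>
        moreover have "a i < a j" if "i < k" "lt i k" "j < k" "lt k j" for i j
          using mono trans that by blast
        ultimately show ?thesis
          using that bounds by (auto simp: L_def U_def)
      qed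
      then have "Max L < Min U"
        using fin ne by simp
      then obtain d where d: "d \<in> D" "Max L < d" "d < Min U"
        using dense by blast
      then have "\<forall>u\<in>L. u < d" "\<forall>v\<in>U. d < v"
        using fin ne by auto
      with d(1) False have "P a k d"
        by (auto simp: P_def L_def U_def)
      then show ?thesis ..
    qed
  qed
  then obtain a where a: "\<And>k. P a k (a k)"
    by blast
  have mono: "a i < a j" if "lt i j" for i j
  proof (cases i j rule: linorder_cases)
    case less
    then show ?thesis
      using a[of j] that by (simp add: P_def)
  next
    case equal
    then show ?thesis
      using irrefl that by simp
  next
    case greater
    then show ?thesis
      using a[of i] that by (simp add: P_def)
  qed
  show thesis
  proof
    show "a 0 = x"
      using a[of 0] by (simp add: P_def)
    show "a k \<in> D" if "k > 0" for k
      using a[of k] that by (simp add: P_def)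
    show "a k \<in> {l<..<r}" for k
      using a[of k] by (simp add: P_def)
    show "a i < a j \<longleftrightarrow> lt i j" for i j
      using mono[of i j] mono[of j i] total[of i j] by fastforce
  qed
qed

text \<open>Each application of \<open>rho\<close> keeps the comparisons among the remaining
  indices. A coherent sequence therefore amounts to one linear order on all indices.\<close>

lemma rho_sequence_less_iff:
  assumes s: "\<And>n. n \<ge> 1 \<Longrightarrow> s n \<in> Sym n" "\<And>n. n \<ge> 1 \<Longrightarrow> rho n (s (Suc n)) = s n"
    and "1 \<le> m" "m \<le> n" "i \<in> {1..m}" "j \<in> {1..m}"
  shows "s n i < s n j \<longleftrightarrow> s m i < s m j"
  using \<open>m \<le> n\<close>
proof (induction rule: dec_induct)
  case (step n)
  have "s (Suc n) i < s (Suc n) j \<longleftrightarrow> rho n (s (Suc n)) i < rho n (s (Suc n)) j"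
    using assms step.hyps by (intro rho_less_iff[symmetric, OF s(1)]) auto
  then show ?case
    using s(2)[of n] step assms by simp
qed simp

lemma ex_realising_sequence:
  assumes s: "\<And>n. n \<ge> 1 \<Longrightarrow> s n \<in> Sym n" "\<And>n. n \<ge> 1 \<Longrightarrow> rho n (s (Suc n)) = s n"
    and dense: "\<And>u v :: real. u < v \<Longrightarrow> \<exists>d\<in>D. u < d \<and> d < v"
    and x: "x \<in> {l<..<r}"
  obtains a :: "nat \<Rightarrow> real"
  where "a 0 = x" "\<And>k. k > 0 \<Longrightarrow> a k \<in> D" "\<And>k. a k \<in> {l<..<r}" "inj a"
    "\<And>n. n \<ge> 1 \<Longrightarrow> Order n (\<lambda>i. a (i - 1)) = s n"
proof -
  \<comment> \<open>Orbit times start at 0 and positions at 1, whence \<open>Suc i\<close>. The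
    level \<open>Suc (max i j)\<close> is the first one containing both positions; by coherence any
    later level gives the same answer.\<close>
  define lt where
    "lt i j \<longleftrightarrow> s (Suc (max i j)) (Suc i) < s (Suc (max i j)) (Suc j)" for i j
  have lt: "lt i j \<longleftrightarrow> s n (Suc i) < s n (Suc j)" if "i < n" "j < n" for i j n
    unfolding lt_def using that by (intro rho_sequence_less_iff[OF s, symmetric]) auto
  have total: "lt i j \<or> lt j i" if "i \<noteq> j" for i j
    using that Sym_inj[OF s(1), of "Suc (max i j)" "Suc i" "Suc j"]
    by (auto simp: lt_def max.commute)
  have trans: "lt i k" if "lt i j" "lt j k" for i j k
  proof -
    \<comment> \<open>The three comparisons live at different levels; \<open>n\<close> is a common
      one, where transitivity is that of the naturals.\<close>
    define n where "n = Suc (max i (max j k))"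
    have "i < n" "j < n" "k < n"
      by (auto simp: n_def)
    then show ?thesis
      using that by (simp add: lt[of _ n])
  qed
  have irrefl: "\<not> lt i i" for i
    by (simp add: lt_def)
  obtain a where a: "a 0 = x" "\<And>k. k > 0 \<Longrightarrow> a k \<in> D" "\<And>k. a k \<in> {l<..<r}"
    and less: "\<And>i j. a i < a j \<longleftrightarrow> lt i j"
    by (rule ex_order_embedding[of lt D x l r];
        (rule irrefl x | erule total dense | erule (1) trans | (rule that; assumption)))
  have inj: "inj a"
  proof (rule injI)
    fix i j assume "a i = a j"
    then have "\<not> lt i j" "\<not> lt j i"
      by (simp_all flip: less)
    then show "i = j"
      using total by blast
  qed
  moreover have "Order n (\<lambda>i. a (i - 1)) = s n" if n: "n \<ge> 1" for n
  proof -
    have "a (i - 1) < a (j - 1) \<longleftrightarrow> s n i < s n j" if "i \<in> {1..n}" "j \<in> {1..n}" for i j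
      using lt[of "i - 1" n "j - 1"] that by (cases i; cases j) (simp_all add: less)
    then show ?thesis
      unfolding Order_eq_iff[OF inj_on_comp_pred[OF inj]] using s(1)[OF n] by (intro conjI ballI)
  qed
  ultimately show thesis
    using that a by blast
qed

section \<open>Nested interval partitions\<close>

text \<open>The intervals are laid end to end from \<open>a\<close>. Half-open intervals leave
  neither gaps nor overlaps, and a weight 0 gives the empty set.\<close>

lemma ex_interval_partition:
  fixes p :: "'a \<Rightarrow> real"
  assumes "finite S" "\<And>s. s \<in> S \<Longrightarrow> 0 \<le> p s"
  shows "\<exists>J. (\<forall>s\<in>S. \<exists>c. J s = {c..<c + p s}) \<and> disjoint_family_on J S \<and>
    (\<Union>s\<in>S. J s) = {a..<a + sum p S}"
  using assms
proof (induction S)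
  case (insert t S)
  then obtain J where J: "\<forall>s\<in>S. \<exists>c. J s = {c..<c + p s}" "disjoint_family_on J S"
    "(\<Union>s\<in>S. J s) = {a..<a + sum p S}"
    by auto
  let ?J = "J(t := {a + sum p S..<a + sum p S + p t})"
  have eq: "?J s = J s" if "s \<in> S" for s
    using that insert.hyps by auto
  have UN: "(\<Union>s\<in>S. ?J s) = {a..<a + sum p S}"
    using J(3) eq by simp
  have "0 \<le> sum p S" "0 \<le> p t"
    using insert.prems by (auto intro: sum_nonneg)
  then have "(\<Union>s\<in>insert t S. ?J s) = {a..<a + sum p (insert t S)}"
    unfolding UN_insert UN using insert.hyps by auto
  moreover have "disjoint_family_on ?J (insert t S)"
    unfolding disjoint_family_on_insert[OF insert.hyps(2)] UN
    using J(2) eq by (auto simp: disjoint_family_on_def)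
  moreover have "\<forall>s\<in>insert t S. \<exists>c. ?J s = {c..<c + p s}"
    using J(1) eq by auto
  ultimately show ?case
    by blast
qed (auto simp: disjoint_family_on_def)

text \<open>Compatibility says that the lengths for the preimages of \<sigma> under
  \<open>rho\<close> add up to the length for \<sigma>, so each interval can be cut into intervals
  for its preimages.\<close>

lemma ex_nested_interval_partitions:
  assumes \<mu>: "\<mu> \<in> Delta_inf"
  obtains J :: "nat \<Rightarrow> (nat \<Rightarrow> nat) \<Rightarrow> real set"
  where "\<And>n \<sigma>. n \<ge> 1 \<Longrightarrow> \<sigma> \<in> Sym n \<Longrightarrow> \<exists>c. J n \<sigma> = {c..<c + \<mu> n \<sigma>}"
    "\<And>n. n \<ge> 1 \<Longrightarrow> disjoint_family_on (J n) (Sym n)"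
    "\<And>n. n \<ge> 1 \<Longrightarrow> (\<Union>\<sigma>\<in>Sym n. J n \<sigma>) = {0..<1}"
    "\<And>n \<sigma>. n \<ge> 1 \<Longrightarrow> \<sigma> \<in> Sym (Suc n) \<Longrightarrow> J (Suc n) \<sigma> \<subseteq> J n (rho n \<sigma>)"
proof -
  have \<mu>_nonneg: "0 \<le> \<mu> n \<sigma>" and \<mu>_sum: "sum (\<mu> n) (Sym n) = 1" if "n \<ge> 1" "\<sigma> \<in> Sym n" for n \<sigma>
    using \<mu> that by (auto simp: Delta_inf_def Delta_def PiE_def Pi_def)
  have comp: "\<mu> n \<sigma> = (\<Sum>\<sigma>' | \<sigma>' \<in> Sym (Suc n) \<and> rho n \<sigma>' = \<sigma>. \<mu> (Suc n) \<sigma>')"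
    if "n \<ge> 1" "\<sigma> \<in> Sym n" for n \<sigma>
    using \<mu> that by (auto simp: Delta_inf_def compatible_def)
  define P where "P n J \<longleftrightarrow> (\<forall>\<sigma>\<in>Sym n. \<exists>c. J \<sigma> = {c..<c + \<mu> n \<sigma>}) \<and>
      disjoint_family_on J (Sym n) \<and> (\<Union>\<sigma>\<in>Sym n. J \<sigma>) = {0..<1::real}" for n J
  have "\<exists>J. \<forall>n. P (Suc n) (J n) \<and> (\<forall>\<sigma>\<in>Sym (Suc (Suc n)). J (Suc n) \<sigma> \<subseteq> J n (rho (Suc n) \<sigma>))"
  \<comment> \<open>The choice starts at 0 while levels start at 1: the function chosen at stage
    \<open>n\<close> belongs to level \<open>Suc n\<close>.\<close>
  proof (rule dependent_nat_choice)
    have "id \<in> Sym (Suc 0)"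
      by (simp add: Sym_def permutes_id)
    then have "sum (\<mu> (Suc 0)) (Sym (Suc 0)) = 1"
      by (rule \<mu>_sum[rotated]) simp
    then show "\<exists>J. P (Suc 0) J"
      using ex_interval_partition[of "Sym (Suc 0)" "\<mu> (Suc 0)" 0] finite_Sym \<mu>_nonneg
      by (simp add: P_def)
  next
    fix J m
    define n where "n = Suc m"
    then have n: "n \<ge> 1"
      by simp
    define T where "T \<sigma> = {\<sigma>'. \<sigma>' \<in> Sym (Suc n) \<and> rho n \<sigma>' = \<sigma>}" for \<sigma>
    assume "P (Suc m) J"
    then have J: "\<And>\<sigma>. \<sigma> \<in> Sym n \<Longrightarrow> \<exists>c. J \<sigma> = {c..<c + \<mu> n \<sigma>}"
      "disjoint_family_on J (Sym n)" "(\<Union>\<sigma>\<in>Sym n. J \<sigma>) = {0..<1}"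
      by (auto simp: P_def n_def)
    have ex: "\<exists>K. (\<forall>\<sigma>'\<in>T \<sigma>. \<exists>c. K \<sigma>' = {c..<c + \<mu> (Suc n) \<sigma>'}) \<and> disjoint_family_on K (T \<sigma>) \<and>
        (\<Union>\<sigma>'\<in>T \<sigma>. K \<sigma>') = J \<sigma>" if \<sigma>: "\<sigma> \<in> Sym n" for \<sigma>
    proof -
      obtain c where "J \<sigma> = {c..<c + \<mu> n \<sigma>}"
        using J(1)[OF \<sigma>] by blast
      moreover have "\<mu> n \<sigma> = sum (\<mu> (Suc n)) (T \<sigma>)"
        using comp[OF n \<sigma>] by (simp add: T_def)
      moreover have "finite (T \<sigma>)" "\<And>\<sigma>'. \<sigma>' \<in> T \<sigma> \<Longrightarrow> 0 \<le> \<mu> (Suc n) \<sigma>'"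
        using finite_Sym[of "Suc n"] \<mu>_nonneg by (auto simp: T_def)
      ultimately show ?thesis
        using ex_interval_partition[of "T \<sigma>" "\<mu> (Suc n)" c] by simp
    qed
    from bchoice[OF ballI[OF ex]] obtain K where *: "\<forall>\<sigma>\<in>Sym n.
        (\<forall>\<sigma>'\<in>T \<sigma>. \<exists>c. K \<sigma> \<sigma>' = {c..<c + \<mu> (Suc n) \<sigma>'}) \<and> disjoint_family_on (K \<sigma>) (T \<sigma>) \<and>
        (\<Union>\<sigma>'\<in>T \<sigma>. K \<sigma> \<sigma>') = J \<sigma>" ..
    have K: "\<And>\<sigma> \<sigma>'. \<sigma> \<in> Sym n \<Longrightarrow> \<sigma>' \<in> T \<sigma> \<Longrightarrow> \<exists>c. K \<sigma> \<sigma>' = {c..<c + \<mu> (Suc n) \<sigma>'}"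
      "\<And>\<sigma>. \<sigma> \<in> Sym n \<Longrightarrow> disjoint_family_on (K \<sigma>) (T \<sigma>)"
      "\<And>\<sigma>. \<sigma> \<in> Sym n \<Longrightarrow> (\<Union>\<sigma>'\<in>T \<sigma>. K \<sigma> \<sigma>') = J \<sigma>"
      using * by simp_all
    \<comment> \<open>Each permutation takes its interval from the subdivision of its parent
      \<open>rho n \<sigma>\<close>. Disjointness comes from that subdivision for equal parents, and
      from the parents' intervals otherwise.\<close>
    define J' where "J' \<sigma> = K (rho n \<sigma>) \<sigma>" for \<sigma>
    have rho: "rho n \<sigma> \<in> Sym n" "\<sigma> \<in> T (rho n \<sigma>)" if "\<sigma> \<in> Sym (Suc n)" for \<sigma>
      using that rho_in_Sym by (auto simp: T_def)
    have sub: "J' \<sigma> \<subseteq> J (rho n \<sigma>)" if "\<sigma> \<in> Sym (Suc n)" for \<sigma>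
      using K(3)[OF rho(1)[OF that]] rho(2)[OF that] by (auto simp: J'_def)
    have "disjoint_family_on J' (Sym (Suc n))"
      unfolding disjoint_family_on_def
    proof (intro ballI impI)
      fix \<sigma> \<tau> assume *: "\<sigma> \<in> Sym (Suc n)" "\<tau> \<in> Sym (Suc n)" "\<sigma> \<noteq> \<tau>"
      show "J' \<sigma> \<inter> J' \<tau> = {}"
      proof (cases "rho n \<sigma> = rho n \<tau>")
        case True
        then show ?thesis
          using disjoint_family_onD[OF K(2)[OF rho(1)[OF *(1)]] rho(2)[OF *(1)] _ *(3)] rho(2)[OF *(2)]
          by (simp add: J'_def)
      next
        case False
        then have "J (rho n \<sigma>) \<inter> J (rho n \<tau>) = {}"
          using disjoint_family_onD[OF J(2)] rho(1) * by blast
        then show ?thesis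
          using sub * by blast
      qed
    qed
    moreover have "(\<Union>\<sigma>\<in>Sym (Suc n). J' \<sigma>) = {0..<1}"
    proof
      show "(\<Union>\<sigma>\<in>Sym (Suc n). J' \<sigma>) \<subseteq> {0..<1}"
        using sub rho(1) J(3) by blast
      show "{0..<1} \<subseteq> (\<Union>\<sigma>\<in>Sym (Suc n). J' \<sigma>)"
      proof
        fix x :: real assume "x \<in> {0..<1}"
        then obtain \<sigma> where \<sigma>: "\<sigma> \<in> Sym n" "x \<in> J \<sigma>"
          using J(3) by blast
        then obtain \<sigma>' where "\<sigma>' \<in> T \<sigma>" "x \<in> K \<sigma> \<sigma>'"
          using K(3) by blast
        then show "x \<in> (\<Union>\<sigma>\<in>Sym (Suc n). J' \<sigma>)"
          by (auto simp: T_def J'_def)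
      qed
    qed
    moreover have "\<exists>c. J' \<sigma> = {c..<c + \<mu> (Suc n) \<sigma>}" if "\<sigma> \<in> Sym (Suc n)" for \<sigma>
      using K(1)[OF rho[OF that]] by (simp add: J'_def)
    ultimately have "P (Suc n) J'"
      by (simp add: P_def)
    with sub show "\<exists>J'. P (Suc (Suc m)) J' \<and> (\<forall>\<sigma>\<in>Sym (Suc (Suc m)). J' \<sigma> \<subseteq> J (rho (Suc m) \<sigma>))"
      unfolding n_def by blast
  qed
  then obtain J where J: "\<And>n. P (Suc n) (J n)"
    "\<And>n \<sigma>. \<sigma> \<in> Sym (Suc (Suc n)) \<Longrightarrow> J (Suc n) \<sigma> \<subseteq> J n (rho (Suc n) \<sigma>)"
    by blast
  have P: "P n (J (n - 1))" if "n \<ge> 1" for n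
    using J(1)[of "n - 1"] that by simp
  show thesis
  proof (rule that[of "\<lambda>n. J (n - 1)"])
    show "J (Suc n - 1) \<sigma> \<subseteq> J (n - 1) (rho n \<sigma>)" if "n \<ge> 1" "\<sigma> \<in> Sym (Suc n)" for n \<sigma>
      using J(2)[of \<sigma> "n - 1"] that by simp
  qed (use P in \<open>auto simp: P_def\<close>)
qed

section \<open>Functions with prescribed orbits\<close>

text \<open>By completeness of Lebesgue measure, \<open>A\<close> may be arbitrary inside
  \<open>Z\<close>. This yields measurable pattern sets although \<open>f\<close> is uncontrolled on
  a null set.\<close>

lemma measure_eq_mod_null:
  assumes "B \<in> sets lebesgue" "Z \<in> null_sets lebesgue" "\<And>x. x \<notin> Z \<Longrightarrow> x \<in> A \<longleftrightarrow> x \<in> B"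
  shows "A \<in> sets lebesgue" "emeasure lebesgue A = emeasure lebesgue B"
proof -
  have "negligible ((B - A) \<union> (A - B))"
    using assms(2,3) unfolding negligible_iff_null_sets
    by (elim null_sets_completion_subset[rotated]) blast
  with assms(1) show A: "A \<in> sets lebesgue"
    by (rule sets_negligible_symdiff)
  have "AE x in lebesgue. x \<in> A \<longleftrightarrow> x \<in> B"
    using AE_not_in[OF assms(2)] assms(3) by (rule eventually_mono)
  then show "emeasure lebesgue A = emeasure lebesgue B"
    using A assms(1) by (rule emeasure_eq_AE)
qed

text \<open>A value occurs at only one place of the family, so sending it to its successor there is
  well defined. All other points go to the default \<open>b\<close>.\<close>

lemma ex_function_with_orbits:
  fixes a :: "'a \<Rightarrow> nat \<Rightarrow> 'b"
  assumes inj: "inj_on (\<lambda>(x, k). a x k) (G \<times> UNIV)"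
  obtains f where "\<And>x k. x \<in> G \<Longrightarrow> (f ^^ k) (a x 0) = a x k"
    "range f \<subseteq> insert b (\<Union>x\<in>G. range (a x))"
proof -
  define g where "g z = inv_into (G \<times> UNIV) (\<lambda>(x, k). a x k) z" for z
  define f where "f z = (if z \<in> (\<lambda>(x, k). a x k) ` (G \<times> UNIV)
    then a (fst (g z)) (Suc (snd (g z))) else b)" for z
  have step: "f (a x k) = a x (Suc k)" if "x \<in> G" for x k
  proof -
    have "g (a x k) = (x, k)"
      using inv_into_f_f[OF inj, of "(x, k)"] that by (simp add: g_def)
    then show ?thesis
      using that by (auto simp: f_def image_iff)
  qed
  have "(f ^^ k) (a x 0) = a x k" if "x \<in> G" for x k
    by (induction k) (simp_all add: step that)
  moreover have "f z \<in> insert b (\<Union>x\<in>G. range (a x))" for z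
    using inv_into_into[of z "\<lambda>(x, k). a x k" "G \<times> UNIV"] by (auto simp: f_def g_def mem_Times_iff)
  ultimately show thesis
    using that by blast
qed

section \<open>Construction of the function and proof of the theorem\<close>

lemma ex_class_A:
  assumes \<mu>: "\<mu> \<in> Delta_inf"
  shows "\<exists>f\<in>class_A. \<forall>n\<ge>1. mu_n n f = \<mu> n"
proof -
  obtain J :: "nat \<Rightarrow> (nat \<Rightarrow> nat) \<Rightarrow> real set"
    where J: "\<And>n \<sigma>. n \<ge> 1 \<Longrightarrow> \<sigma> \<in> Sym n \<Longrightarrow> \<exists>c. J n \<sigma> = {c..<c + \<mu> n \<sigma>}"
      and J_disj: "\<And>n. n \<ge> 1 \<Longrightarrow> disjoint_family_on (J n) (Sym n)"
      and J_UN: "\<And>n. n \<ge> 1 \<Longrightarrow> (\<Union>\<sigma>\<in>Sym n. J n \<sigma>) = {0..<1}"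
      and J_rho: "\<And>n \<sigma>. n \<ge> 1 \<Longrightarrow> \<sigma> \<in> Sym (Suc n) \<Longrightarrow> J (Suc n) \<sigma> \<subseteq> J n (rho n \<sigma>)"
    using ex_nested_interval_partitions[OF \<mu>] by blast
  obtain N :: "real set" and D :: "real \<Rightarrow> real set"
    where N: "N \<in> null_sets lebesgue" and DN: "\<And>x. D x \<subseteq> N"
      and D_disj: "\<And>x y. x \<noteq> y \<Longrightarrow> D x \<inter> D y = {}"
      and D_dense: "\<And>x u v. u < v \<Longrightarrow> \<exists>d\<in>D x. u < d \<and> d < v"
    using ex_null_disjoint_dense_family by blast
  \<comment> \<open>Removing \<open>N\<close> keeps starting points apart from all later orbit
    points; the open interval leaves room on both sides of each starting point.\<close>
  define G where "G = {0<..<1} - N"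
  \<comment> \<open>\<open>s x n\<close> is the permutation whose interval at level \<open>n\<close>
    contains \<open>x\<close>; nesting makes the sequence coherent.\<close>
  define s where "s x n = (SOME \<sigma>. \<sigma> \<in> Sym n \<and> x \<in> J n \<sigma>)" for x n
  have J_uniq: "\<sigma> = \<tau>" if "n \<ge> 1" "\<sigma> \<in> Sym n" "\<tau> \<in> Sym n" "x \<in> J n \<sigma>" "x \<in> J n \<tau>" for n \<sigma> \<tau> x
    using disjoint_family_onD[OF J_disj[OF that(1)] that(2,3)] that(4,5) by blast
  have s: "s x n \<in> Sym n" "x \<in> J n (s x n)" if "x \<in> G" "n \<ge> 1" for x n
  proof -
    have "x \<in> (\<Union>\<sigma>\<in>Sym n. J n \<sigma>)"
      using that(1) by (simp add: J_UN[OF that(2)] G_def)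
    then have "\<exists>\<sigma>. \<sigma> \<in> Sym n \<and> x \<in> J n \<sigma>"
      by blast
    then have "s x n \<in> Sym n \<and> x \<in> J n (s x n)"
      unfolding s_def by (rule someI_ex)
    then show "s x n \<in> Sym n" "x \<in> J n (s x n)"
      by simp_all
  qed
  have s_iff: "s x n = \<sigma> \<longleftrightarrow> x \<in> J n \<sigma>" if "x \<in> G" "n \<ge> 1" "\<sigma> \<in> Sym n" for x n \<sigma>
    using J_uniq[OF that(2) that(3) s(1)[OF that(1,2)]] s(2)[OF that(1,2)] by blast
  have s_rho: "rho n (s x (Suc n)) = s x n" if "x \<in> G" "n \<ge> 1" for x n
  proof -
    have *: "s x (Suc n) \<in> Sym (Suc n)" "x \<in> J (Suc n) (s x (Suc n))"
      using s[OF that(1), of "Suc n"] by simp_all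
    then have "x \<in> J n (rho n (s x (Suc n)))"
      using J_rho[OF that(2)] by blast
    then show ?thesis
      using s_iff[OF that rho_in_Sym[OF *(1)]] by simp
  qed
  have "\<exists>a. a 0 = x \<and> (\<forall>k>0. a k \<in> D x) \<and> (\<forall>k. a k \<in> {0<..<1}) \<and> inj a \<and>
      (\<forall>n\<ge>1. Order n (\<lambda>i. a (i - 1)) = s x n)" if x: "x \<in> G" for x
  proof -
    have x01: "x \<in> {0<..<1}"
      using x by (simp add: G_def)
    obtain a where "a 0 = x" "\<And>k. k > 0 \<Longrightarrow> a k \<in> D x" "\<And>k. a k \<in> {0<..<1}" "inj a"
      "\<And>n. n \<ge> 1 \<Longrightarrow> Order n (\<lambda>i. a (i - 1)) = s x n"
      by (rule ex_realising_sequence[of "s x" "D x" x 0 1];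
          (erule s(1)[OF x] s_rho[OF x] D_dense | rule x01 | (rule that; assumption)))
    then show ?thesis
      by blast
  qed
  then obtain a where "\<And>x. x \<in> G \<Longrightarrow> a x 0 = x \<and> (\<forall>k>0. a x k \<in> D x) \<and>
      (\<forall>k. a x k \<in> {0<..<1}) \<and> inj (a x) \<and> (\<forall>n\<ge>1. Order n (\<lambda>i. a x (i - 1)) = s x n)"
    by metis
  then have a0: "\<And>x. x \<in> G \<Longrightarrow> a x 0 = x"
    and aD: "\<And>x k. x \<in> G \<Longrightarrow> k > 0 \<Longrightarrow> a x k \<in> D x"
    and a_bounds: "\<And>x k. x \<in> G \<Longrightarrow> a x k \<in> {0<..<1}"
    and a_inj: "\<And>x. x \<in> G \<Longrightarrow> inj (a x)"
    and a_Order: "\<And>x n. x \<in> G \<Longrightarrow> n \<ge> 1 \<Longrightarrow> Order n (\<lambda>i. a x (i - 1)) = s x n"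
    by blast+
  \<comment> \<open>Membership in \<open>N\<close> tells time 0 from later times. A value common to
    two sequences is then the start of both or lies in \<open>D x \<inter> D y\<close>, and either
    way \<open>x = y\<close>.\<close>
  have aN: "a x k \<in> N \<longleftrightarrow> k > 0" if "x \<in> G" for x k
    using that a0[OF that] aD[OF that, of k] DN[of x] by (cases "k = 0") (auto simp: G_def)
  have "inj_on (\<lambda>(x, k). a x k) (G \<times> UNIV)"
  proof (rule inj_onI, clarify)
    fix x y k l assume xy: "x \<in> G" "y \<in> G" and eq: "a x k = a y l"
    have "x = y"
    proof (cases "k = 0")
      case True
      then have "l = 0"
        using aN[OF xy(1), of k] aN[OF xy(2), of l] eq by simp
      with True show ?thesis
        using eq a0 xy by simp
    next
      case False
      then have "l > 0"
        using aN[OF xy(1), of k] aN[OF xy(2), of l] eq by simp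
      with False have "a x k \<in> D x \<inter> D y"
        using aD[OF xy(1), of k] aD[OF xy(2), of l] eq by simp
      then show ?thesis
        using D_disj by blast
    qed
    then show "x = y \<and> k = l"
      using eq injD[OF a_inj[OF xy(1)]] by simp
  qed
  then obtain f where f_iter: "\<And>x k. x \<in> G \<Longrightarrow> (f ^^ k) (a x 0) = a x k"
    and f_range: "range f \<subseteq> insert 0 (\<Union>x\<in>G. range (a x))"
    \<comment> \<open>The default 0 keeps the values of \<open>f\<close> in the unit
      interval.\<close>
    by (rule ex_function_with_orbits[where b = 0]) (rule that)
  have iter: "(f ^^ k) x = a x k" if "x \<in> G" for x k
    using f_iter[OF that] a0[OF that] by simp
  have "f z \<in> {0..1}" for z
  proof -
    have "f z \<in> insert 0 (\<Union>x\<in>G. range (a x))"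
      using f_range by blast
    then consider "f z = 0" | x k where "x \<in> G" "f z = a x k"
      by blast
    then show ?thesis
    proof cases
      case 2
      then show ?thesis
        using a_bounds[of x k] by simp
    qed simp
  qed
  then have f_funcset: "f \<in> {0..1} \<rightarrow> {0..1}"
    by blast
  have orbit: "x \<in> infinite_orbit_points f" if "x \<in> G" for x
    using that range_inj_infinite[OF a_inj[OF that]]
    by (simp add: infinite_orbit_points_def iter[OF that]) (simp add: G_def)
  have pattern: "x \<in> pattern_set f n \<sigma> \<longleftrightarrow> x \<in> J n \<sigma>" if "x \<in> G" "n \<ge> 1" "\<sigma> \<in> Sym n" for x n \<sigma>
    using orbit[OF that(1)] a_Order[OF that(1,2)] s_iff[OF that]
    by (simp add: pattern_set_def iter[OF that(1)])
  \<comment> \<open>Off \<open>Z\<close>, a point either lies in \<open>G\<close>, where its orbit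
    is known, or outside the unit interval, where it is in none of the sets compared.\<close>
  define Z where "Z = N \<union> {0, 1}"
  have Z: "Z \<in> null_sets lebesgue"
    using N negligible_finite[of "{0, 1 :: real}"]
    by (auto simp: Z_def negligible_iff_null_sets)
  have G_cases: "x \<in> G \<or> x \<notin> {0..1}" if "x \<notin> Z" for x
    using that by (auto simp: Z_def G_def)
  have orbit_iff: "x \<in> infinite_orbit_points f \<longleftrightarrow> x \<in> {0..1}" if "x \<notin> Z" for x
    using G_cases[OF that] orbit by (auto simp: infinite_orbit_points_def)
  have pattern_iff: "x \<in> pattern_set f n \<sigma> \<longleftrightarrow> x \<in> J n \<sigma>"
    if "x \<notin> Z" "n \<ge> 1" "\<sigma> \<in> Sym n" for x n \<sigma>
  proof (cases "x \<in> G")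
    case False
    then have "x \<notin> {0..1}"
      using G_cases[OF that(1)] by blast
    moreover have "J n \<sigma> \<subseteq> {0..<1}"
      using J_UN[OF that(2)] that(3) by blast
    ultimately show ?thesis
      by (auto simp: pattern_set_def infinite_orbit_points_def)
  qed (use pattern that in simp)
  have J_sets: "J n \<sigma> \<in> sets lebesgue" if "n \<ge> 1" "\<sigma> \<in> Sym n" for n \<sigma>
    using J[OF that] by auto
  have f: "f \<in> class_A"
    unfolding class_A_def
  proof (intro CollectI conjI allI impI ballI)
    show "emeasure lebesgue (infinite_orbit_points f) = 1"
      using measure_eq_mod_null(2)[of "{0..1}" Z, OF _ Z orbit_iff] by simp
    show "pattern_set f n \<sigma> \<in> sets lebesgue" if "1 \<le> n" "\<sigma> \<in> Sym n" for n \<sigma>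
      using measure_eq_mod_null(1)[OF J_sets[OF that] Z pattern_iff[OF _ that]] .
  qed (rule f_funcset)
  have "mu_n n f \<sigma> = \<mu> n \<sigma>" if n: "n \<ge> 1" for n \<sigma>
  proof (cases "\<sigma> \<in> Sym n")
    case True
    have "0 \<le> \<mu> n \<sigma>"
      using \<mu> n True by (auto simp: Delta_inf_def Delta_def PiE_def Pi_def)
    moreover obtain c where "J n \<sigma> = {c..<c + \<mu> n \<sigma>}"
      using J[OF n True] by blast
    ultimately have "emeasure lebesgue (J n \<sigma>) = ennreal (\<mu> n \<sigma>)"
      by simp
    then show ?thesis
      using measure_eq_mod_null(2)[OF J_sets[OF n True] Z pattern_iff[OF _ n True]] \<open>0 \<le> \<mu> n \<sigma>\<close>
      by (simp add: mu_n_def measure_def)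
  next
    case False
    \<comment> \<open>Outside \<open>Sym n\<close> both sides are 0, by the convention in
      \<open>Delta\<close>.\<close>
    have "mu f n \<in> Delta n" "\<mu> n \<in> Delta n"
      using \<mu> mu_in_Delta_inf[OF f] n by (auto simp: Delta_inf_def)
    with False n show ?thesis
      by (simp add: Delta_def mu_def)
  qed
  with f show ?thesis
    by blast
qed

theorem theorem1p1:
  "(\<forall>\<mu>\<in>Delta_inf. \<exists>f\<in>class_A. \<forall>n\<ge>1. mu_n n f = \<mu> n) \<and> mu ` class_A = Delta_inf"
proof (intro conjI ballI)
  show "\<exists>f\<in>class_A. \<forall>n\<ge>1. mu_n n f = \<mu> n" if "\<mu> \<in> Delta_inf" for \<mu>
    using that by (rule ex_class_A)
  show "mu ` class_A = Delta_inf"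
  proof
    show "Delta_inf \<subseteq> mu ` class_A"
    proof
      fix \<mu> assume \<mu>: "\<mu> \<in> Delta_inf"
      then obtain f where f: "f \<in> class_A" "\<forall>n\<ge>1. mu_n n f = \<mu> n"
        using ex_class_A by blast
      \<comment> \<open>Equality of functions also concerns index 0, where both sides are
        \<open>undefined\<close>.\<close>
      have "\<mu> \<in> extensional {1..}"
        using \<mu> by (simp add: Delta_inf_def PiE_def)
      with f(2) have "mu f = \<mu>"
        unfolding mu_def by (intro extensionalityI[of _ "{1..}"]) auto
      with f(1) show "\<mu> \<in> mu ` class_A"
        by blast
    qed
  qed (use mu_in_Delta_inf in blast)
qed

end
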